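(* Let $n\ge 3$, $r_1,\ldots,r_n\ge 2$ integers, $t\in[n]$, and $s=n$. The ideal $I^{\langle n,t\rangle}$ of $R$ has exactly two minimal primes: the ideal $\widetilde{I}^{\langle n,t\rangle}$ and the monomial prime $\big(x_a : a\in\mathcal{N},\ a\ne(1,\ldots,1),(r_1,\ldots,r_n)\big)$.
   Context: Notation: $[r]=\{1,\ldots,r\}$, $\mathcal{N}=[r_1]\times\cdots\times[r_n]$, $\Bbbk$ is an arbitrary field. $R=\Bbbk[x_a: a\in\mathcal{N}]$ is the polynomial ring where the variables are identified by $x_a=x_b$ if and only if $a,b$ are $n$-equivalent, i.e. $\sum_{i=1}^n a_i=\sum_{i=1}^n b_i$ (so variables correspond bijectively to the possible values of this sum). For $i\in[n]$ and $a,b\in\mathcal{N}$, $\mathrm{sw}(i,a,b)\in\mathcal{N}$ is obtained from $a$ by replacing its $i$-th component by $b_i$; $f_{i,a,b}=x_ax_b-x_{\mathrm{sw}(i,a,b)}x_{\mathrm{sw}(i,b,a)}$; $\mathrm{d}(a,b)=\#\{i\in[n]: a_i\ne b_i\}$. The ideals are $I^{\langle n,t\rangle}=(f_{i,a,b}: a,b\in\mathcal{N},\ \mathrm{d}(a,b)=2,\ i\in[t])$ and $\widetilde{I}^{\langle n,t\rangle}=(f_{i,a,b}: a,b\in\mathcal{N},\ i\in[t])$. *)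

theory Defs
  imports "HOL-Library.Poly_Mapping" "HOL-Library.FuncSet" "HOL-Algebra.Ideal"
begin

text \<open>
  A polynomial over \<open>'k\<close> in commuting variables indexed by \<open>'v\<close> is an element of
  \<^typ>\<open>('v \<Rightarrow>\<^sub>0 nat) \<Rightarrow>\<^sub>0 'k\<close>, mapping exponent vectors to coefficients.
  \<open>polynomial_ring V\<close> is the polynomial ring whose set of variables is exactly \<open>V\<close>.
\<close>

type_synonym ('v, 'k) mpoly = "('v \<Rightarrow>\<^sub>0 nat) \<Rightarrow>\<^sub>0 'k"

definition polynomial_ring :: "'v set \<Rightarrow> ('v, 'k::field) mpoly ring" where
  "polynomial_ring V =
     \<lparr>carrier = {p. \<forall>m \<in> Poly_Mapping.keys p. Poly_Mapping.keys m \<subseteq> V},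
      mult = (*), one = 1, zero = 0, add = (+)\<rparr>"

definition index_set :: "nat \<Rightarrow> (nat \<Rightarrow> nat) \<Rightarrow> (nat \<Rightarrow> nat) set" where
  "index_set n r = (\<Pi>\<^sub>E i \<in> {1..n}. {1..r i})"

definition n_equivalent :: "nat \<Rightarrow> (nat \<Rightarrow> nat) \<Rightarrow> (nat \<Rightarrow> nat) \<Rightarrow> bool" where
  "n_equivalent n a b \<longleftrightarrow> (\<Sum>i = 1..n. a i) = (\<Sum>i = 1..n. b i)"

text \<open>
  The identification of variables is realised by taking as variables the natural
  numbers that occur as component sums; see \<open>xvar_eq_iff\<close> below.
\<close>

definition xvar :: "nat \<Rightarrow> (nat \<Rightarrow> nat) \<Rightarrow> (nat, 'k::field) mpoly" where
  "xvar n a = Poly_Mapping.single (Poly_Mapping.single (\<Sum>i = 1..n. a i) 1) 1"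

definition R :: "nat \<Rightarrow> (nat \<Rightarrow> nat) \<Rightarrow> (nat, 'k::field) mpoly ring" where
  "R n r = polynomial_ring ((\<lambda>a. \<Sum>i = 1..n. a i) ` index_set n r)"

definition sw :: "nat \<Rightarrow> (nat \<Rightarrow> nat) \<Rightarrow> (nat \<Rightarrow> nat) \<Rightarrow> nat \<Rightarrow> nat" where
  "sw i a b = a(i := b i)"

definition f :: "nat \<Rightarrow> nat \<Rightarrow> (nat \<Rightarrow> nat) \<Rightarrow> (nat \<Rightarrow> nat) \<Rightarrow> (nat, 'k::field) mpoly" where
  "f n i a b = xvar n a * xvar n b - xvar n (sw i a b) * xvar n (sw i b a)"

definition d :: "nat \<Rightarrow> (nat \<Rightarrow> nat) \<Rightarrow> (nat \<Rightarrow> nat) \<Rightarrow> nat" where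
  "d n a b = card {i \<in> {1..n}. a i \<noteq> b i}"

definition I_ideal :: "nat \<Rightarrow> (nat \<Rightarrow> nat) \<Rightarrow> nat \<Rightarrow> (nat, 'k::field) mpoly set" where
  "I_ideal n r t =
     Idl\<^bsub>R n r\<^esub> {f n i a b |i a b. a \<in> index_set n r \<and> b \<in> index_set n r \<and> d n a b = 2 \<and> i \<in> {1..t}}"

definition I_tilde :: "nat \<Rightarrow> (nat \<Rightarrow> nat) \<Rightarrow> nat \<Rightarrow> (nat, 'k::field) mpoly set" where
  "I_tilde n r t =
     Idl\<^bsub>R n r\<^esub> {f n i a b |i a b. a \<in> index_set n r \<and> b \<in> index_set n r \<and> i \<in> {1..t}}"

definition monomial_ideal :: "nat \<Rightarrow> (nat \<Rightarrow> nat) \<Rightarrow> (nat, 'k::field) mpoly set" where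
  "monomial_ideal n r =
     Idl\<^bsub>R n r\<^esub> {xvar n a |a. a \<in> index_set n r \<and> a \<noteq> (\<lambda>i \<in> {1..n}. 1) \<and> a \<noteq> (\<lambda>i \<in> {1..n}. r i)}"

definition minimal_primes :: "('a, 'b) ring_scheme \<Rightarrow> 'a set \<Rightarrow> 'a set set" where
  "minimal_primes A J =
     {P. primeideal P A \<and> J \<subseteq> P \<and> (\<forall>Q. primeideal Q A \<and> J \<subseteq> Q \<and> Q \<subseteq> P \<longrightarrow> Q = P)}"

lemma xvar_eq_iff: "(xvar n a :: (nat, 'k::field) mpoly) = xvar n b \<longleftrightarrow> n_equivalent n a b"
proof
  assume "(xvar n a :: (nat, 'k) mpoly) = xvar n b"
  then have "Poly_Mapping.keys (xvar n a :: (nat, 'k) mpoly) = Poly_Mapping.keys (xvar n b :: (nat, 'k) mpoly)"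
    by (rule arg_cong)
  then have "Poly_Mapping.single (\<Sum>i = 1..n. a i) (1::nat) = Poly_Mapping.single (\<Sum>i = 1..n. b i) 1"
    unfolding xvar_def keys_single by simp
  then have "Poly_Mapping.keys (Poly_Mapping.single (\<Sum>i = 1..n. a i) (1::nat))
      = Poly_Mapping.keys (Poly_Mapping.single (\<Sum>i = 1..n. b i) (1::nat))"
    by (rule arg_cong)
  then show "n_equivalent n a b"
    unfolding n_equivalent_def keys_single by simp
qed (simp add: xvar_def n_equivalent_def)

lemma xvar_in_R: "a \<in> index_set n r \<Longrightarrow> (xvar n a :: (nat, 'k::field) mpoly) \<in> carrier (R n r)"
  by (auto simp: xvar_def R_def polynomial_ring_def)

lemma cring_polynomial_ring: "cring (polynomial_ring V :: ('v, 'k::field) mpoly ring)"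
proof -
  let ?A = "polynomial_ring V :: ('v, 'k) mpoly ring"
  have add: "p + q \<in> carrier ?A" if "p \<in> carrier ?A" "q \<in> carrier ?A" for p q
    using that keys_add[of p q] by (auto simp: polynomial_ring_def)
  have neg: "- p \<in> carrier ?A" if "p \<in> carrier ?A" for p
    using that by (auto simp: polynomial_ring_def)
  have mult: "p * q \<in> carrier ?A" if "p \<in> carrier ?A" "q \<in> carrier ?A" for p q
    unfolding polynomial_ring_def
  proof (clarsimp)
    fix m x assume m: "m \<in> Poly_Mapping.keys (p * q)" and x: "x \<in> Poly_Mapping.keys m"
    obtain u v where "m = u + v" "u \<in> Poly_Mapping.keys p" "v \<in> Poly_Mapping.keys q"
      using m keys_mult[of p q] by blast
    then show "x \<in> V"
      using that x keys_add[of u v] by (fastforce simp: polynomial_ring_def)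
  qed
  have ops: "p \<oplus>\<^bsub>?A\<^esub> q = p + q" "p \<otimes>\<^bsub>?A\<^esub> q = p * q" "\<zero>\<^bsub>?A\<^esub> = 0" "\<one>\<^bsub>?A\<^esub> = 1" for p q
    by (simp_all add: polynomial_ring_def)
  have zero: "0 \<in> carrier ?A" and one: "1 \<in> carrier ?A"
    by (simp_all add: polynomial_ring_def)
  show ?thesis
  proof (rule cringI)
    show "abelian_group ?A"
    proof (rule abelian_groupI, unfold ops)
      show "\<exists>q\<in>carrier ?A. q + p = 0" if "p \<in> carrier ?A" for p
        using neg[OF that] by (intro bexI[of _ "- p"]) simp_all
      show "p + q = q + p" for p q :: "('v, 'k) mpoly"
        by (rule add.commute)
    qed (simp_all only: add zero add.assoc add_0_left)
    show "Group.comm_monoid ?A"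
    proof (rule Group.comm_monoidI, unfold ops)
      show "p * q = q * p" for p q :: "('v, 'k) mpoly"
        by (rule mult.commute)
    qed (simp_all only: mult one mult.assoc mult_1_left)
    show "(p \<oplus>\<^bsub>?A\<^esub> q) \<otimes>\<^bsub>?A\<^esub> s = p \<otimes>\<^bsub>?A\<^esub> s \<oplus>\<^bsub>?A\<^esub> q \<otimes>\<^bsub>?A\<^esub> s" for p q s
      unfolding ops by (rule distrib_right)
  qed
qed

lemma cring_R: "cring (R n r :: (nat, 'k::field) mpoly ring)"
  unfolding R_def by (rule cring_polynomial_ring)

end

theory Submission
  imports Defs "HOL-Computational_Algebra.Polynomial"
begin

text \<open>
  Put \<open>l = n\<close> and \<open>h = r\<^sub>1 + \<dots> + r\<^sub>n\<close>. The variables of the ring are \<open>y\<^sub>l, \<dots>, y\<^sub>h\<close>, one for each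
  possible component sum. Two primes of this ring are the ideal \<open>C\<close> of the rational
  normal curve, which is the kernel of \<open>y\<^sub>v \<mapsto> S T\<^sup>v\<close>, and the ideal \<open>L\<close> of the line joining its
  end points, which is generated by the variables other than \<open>y\<^sub>l\<close> and \<open>y\<^sub>h\<close>. The theorem
  says that \<open>C\<close> is the ideal generated by all \<open>f n i a b\<close>, that \<open>L\<close> is the given monomial
  ideal, and that these are the minimal primes of the ideal generated by those
  \<open>f n i a b\<close> for which \<open>a\<close> and \<open>b\<close> have distance two.

  The main point is that the latter ideal contains the consecutive minors
  \<open>y\<^sub>c y\<^sub>c\<^sub>+\<^sub>2 - y\<^sub>c\<^sub>+\<^sub>1\<^sup>2\<close> (\<open>consecutive_minor_is_generator\<close>). If a prime \<open>Q\<close> contains these,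
  and if it contains one of the variables, then it contains all interior variables, hence
  \<open>L\<close>. Otherwise the \<open>y\<^sub>c\<close> form a geometric progression with nonzero terms modulo \<open>Q\<close>, so
  that \<open>Q\<close> contains all binomials \<open>y\<^sub>A y\<^sub>B\<^sub>+\<^sub>1 - y\<^sub>A\<^sub>+\<^sub>1 y\<^sub>B\<close>, hence \<open>C\<close>
  (\<open>prime_over_consecutive_minors\<close>). Conversely, the ideal lies in \<open>C\<close> because exchanging
  components preserves the total sum, and in \<open>L\<close> because the two extreme tuples have
  distance \<open>n \<ge> 3\<close>. Neither of \<open>C\<close> and \<open>L\<close> contains the other.

  That the binomials \<open>y\<^sub>A y\<^sub>B\<^sub>+\<^sub>1 - y\<^sub>A\<^sub>+\<^sub>1 y\<^sub>B\<close> generate \<open>C\<close> (\<open>curve_ideal_least\<close>) rests on a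
  description of kernels of monomial maps (\<open>kernel_subset_ideal\<close>): it is enough that
  monomials with the same degree and the same sum of indices are congruent. To identify
  \<open>C\<close> with the ideal generated by all \<open>f n i a b\<close>, the generators with \<open>i = t\<close> suffice:
  they are the 2-minors of a Hankel matrix, and all such matrices of at least two rows
  and two columns have the same ideal of minors (\<open>hankel_minors_imp_adjacent\<close>).
\<close>

section \<open>Ideals of polynomial rings\<close>

lemma polynomial_ring_simps:
  "p \<oplus>\<^bsub>polynomial_ring V\<^esub> q = p + q" "p \<otimes>\<^bsub>polynomial_ring V\<^esub> q = p * q"
  "\<zero>\<^bsub>polynomial_ring V\<^esub> = 0" "\<one>\<^bsub>polynomial_ring V\<^esub> = 1"
  by (simp_all add: polynomial_ring_def)

lemma carrier_polynomial_ring: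
  "p \<in> carrier (polynomial_ring V) \<longleftrightarrow>
     (\<forall>m\<in>Poly_Mapping.keys p. Poly_Mapping.keys m \<subseteq> V)"
  by (simp add: polynomial_ring_def)

lemma single_in_carrier:
  "Poly_Mapping.keys m \<subseteq> V \<Longrightarrow> Poly_Mapping.single m c \<in> carrier (polynomial_ring V)"
  by (simp add: carrier_polynomial_ring)

lemma uminus_polynomial_ring:
  assumes "p \<in> carrier (polynomial_ring V)"
  shows "\<ominus>\<^bsub>polynomial_ring V\<^esub> p = - p"
proof -
  interpret cring "polynomial_ring V"
    by (rule cring_polynomial_ring)
  have "- p \<in> carrier (polynomial_ring V)"
    using assms by (simp add: carrier_polynomial_ring)
  then show ?thesis
    using assms by (metis add.right_inverse minus_equality add.commute polynomial_ring_simps(1,3))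
qed

lemma polynomial_ideal_closed:
  assumes "ideal J (polynomial_ring V)"
  shows "0 \<in> J"
    and "p \<in> J \<Longrightarrow> q \<in> J \<Longrightarrow> p + q \<in> J"
    and "p \<in> J \<Longrightarrow> q \<in> J \<Longrightarrow> p - q \<in> J"
    and "p \<in> J \<Longrightarrow> - p \<in> J"
    and "p \<in> J \<Longrightarrow> q \<in> carrier (polynomial_ring V) \<Longrightarrow> q * p \<in> J"
    and "p \<in> J \<Longrightarrow> p \<in> carrier (polynomial_ring V)"
proof -
  interpret ideal J "polynomial_ring V" by (rule assms)
  note sub = is_additive_subgroup
  show "0 \<in> J"
    using additive_subgroup.zero_closed[OF sub] by (simp add: polynomial_ring_simps)
  show add: "p + q \<in> J" if "p \<in> J" "q \<in> J" for p q
    using additive_subgroup.a_closed[OF sub that] by (simp add: polynomial_ring_simps)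
  show neg: "- p \<in> J" if "p \<in> J" for p
    using additive_subgroup.a_inv_closed[OF sub that] Icarr[OF that] by (simp add: uminus_polynomial_ring)
  show "p - q \<in> J" if "p \<in> J" "q \<in> J" for p q
    using add[OF that(1) neg[OF that(2)]] by simp
  show "q * p \<in> J" if "p \<in> J" "q \<in> carrier (polynomial_ring V)" for p q
    using I_l_closed[OF that] by (simp add: polynomial_ring_simps)
  show "p \<in> carrier (polynomial_ring V)" if "p \<in> J" for p
    using Icarr[OF that] .
qed

lemma primeideal_mult_cases:
  assumes "primeideal Q (polynomial_ring V)" "p * q \<in> Q"
    "p \<in> carrier (polynomial_ring V)" "q \<in> carrier (polynomial_ring V)"
  shows "p \<in> Q \<or> q \<in> Q"
  using primeideal.I_prime[OF assms(1) assms(3,4)] assms(2) by (simp add: polynomial_ring_simps)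

lemma genideal_polynomial_ring:
  assumes "S \<subseteq> carrier (polynomial_ring V)"
  shows "ideal (Idl\<^bsub>polynomial_ring V\<^esub> S) (polynomial_ring V)" "S \<subseteq> Idl\<^bsub>polynomial_ring V\<^esub> S"
    "ideal J (polynomial_ring V) \<Longrightarrow> S \<subseteq> J \<Longrightarrow> Idl\<^bsub>polynomial_ring V\<^esub> S \<subseteq> J"
proof -
  interpret cring "polynomial_ring V"
    by (rule cring_polynomial_ring)
  show "ideal (Idl\<^bsub>polynomial_ring V\<^esub> S) (polynomial_ring V)"
    by (rule genideal_ideal[OF assms])
  show "S \<subseteq> Idl\<^bsub>polynomial_ring V\<^esub> S"
    by (rule genideal_self[OF assms])
  show "Idl\<^bsub>polynomial_ring V\<^esub> S \<subseteq> J" if "ideal J (polynomial_ring V)" "S \<subseteq> J"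
    by (rule genideal_minimal[OF that])
qed

lemma genideal_eqI:
  assumes "ideal J (polynomial_ring V)" "S \<subseteq> J"
    and "\<And>J'. ideal J' (polynomial_ring V) \<Longrightarrow> S \<subseteq> J' \<Longrightarrow> J \<subseteq> J'"
  shows "Idl\<^bsub>polynomial_ring V\<^esub> S = J"
proof -
  have S: "S \<subseteq> carrier (polynomial_ring V)"
    using polynomial_ideal_closed(6)[OF assms(1)] assms(2) by blast
  show ?thesis
    using genideal_polynomial_ring(3)[OF S assms(1,2)]
      assms(3)[OF genideal_polynomial_ring(1,2)[OF S]] by blast
qed

section \<open>Kernels of monomial maps\<close>

text \<open>
  Two-variable polynomials are enough as targets: both primes of the theorem are
  kernels of maps into a polynomial ring in two variables, whose type is an integral
  domain. A single type of targets keeps the kernel results uniform.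
\<close>

definition lin_ext :: "('m \<Rightarrow> 'k poly poly) \<Rightarrow> ('m \<Rightarrow>\<^sub>0 'k::field) \<Rightarrow> 'k poly poly" where
  "lin_ext h p = (\<Sum>m\<in>Poly_Mapping.keys p. smult [:Poly_Mapping.lookup p m:] (h m))"

lemma lin_ext_superset:
  assumes "finite S" "Poly_Mapping.keys p \<subseteq> S"
  shows "lin_ext h p = (\<Sum>m\<in>S. smult [:Poly_Mapping.lookup p m:] (h m))"
  unfolding lin_ext_def
  by (rule sum.mono_neutral_left) (use assms in \<open>auto simp: in_keys_iff\<close>)

lemma lin_ext_zero: "lin_ext h 0 = 0"
  by (simp add: lin_ext_def)

lemma lin_ext_single: "lin_ext h (Poly_Mapping.single m c) = smult [:c:] (h m)"
  by (simp add: lin_ext_def)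

lemma lin_ext_add: "lin_ext h (p + q) = lin_ext h p + lin_ext h q"
proof -
  let ?S = "Poly_Mapping.keys p \<union> Poly_Mapping.keys q"
  have "lin_ext h (p + q) = (\<Sum>m\<in>?S. smult [:Poly_Mapping.lookup (p + q) m:] (h m))"
    using keys_add[of p q] by (intro lin_ext_superset) auto
  also have "\<dots> = (\<Sum>m\<in>?S. smult [:Poly_Mapping.lookup p m:] (h m))
      + (\<Sum>m\<in>?S. smult [:Poly_Mapping.lookup q m:] (h m))"
    by (simp only: lookup_add sum.distrib [symmetric] smult_add_left [symmetric]) simp
  also have "\<dots> = lin_ext h p + lin_ext h q"
    by (subst (1 2) lin_ext_superset[of ?S]) auto
  finally show ?thesis .
qed

lemma lin_ext_diff: "lin_ext h (p - q) = lin_ext h p - lin_ext h q"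
  using lin_ext_add[of h "p - q" q] by simp

lemma lin_ext_sum: "lin_ext h (sum g S) = (\<Sum>x\<in>S. lin_ext h (g x))"
  by (induction S rule: infinite_finite_induct) (simp_all add: lin_ext_zero lin_ext_add)

lemma sum_monomials:
  "p = (\<Sum>m\<in>Poly_Mapping.keys p. Poly_Mapping.single m (Poly_Mapping.lookup p m))"
  by (rule poly_mapping_eqI)
    (auto simp: lookup_sum lookup_single when_def in_keys_iff sum.delta')

lemma lin_ext_mult:
  fixes h :: "'m::monoid_add \<Rightarrow> 'k::field poly poly"
  assumes "\<And>m m'. h (m + m') = h m * h m'"
  shows "lin_ext h (p * q) = lin_ext h p * lin_ext h q"
proof -
  let ?s = "\<lambda>p m. Poly_Mapping.single m (Poly_Mapping.lookup p m)"
  have "p * q = (\<Sum>m\<in>Poly_Mapping.keys p. ?s p m) * (\<Sum>m\<in>Poly_Mapping.keys q. ?s q m)"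
    using sum_monomials[of p] sum_monomials[of q] by simp
  then have "lin_ext h (p * q) =
      (\<Sum>m\<in>Poly_Mapping.keys p. \<Sum>m'\<in>Poly_Mapping.keys q. lin_ext h (?s p m * ?s q m'))"
    by (simp add: lin_ext_sum sum_product)
  also have "\<dots> = lin_ext h p * lin_ext h q"
    by (simp add: mult_single lin_ext_single assms lin_ext_def [of _ p] lin_ext_def [of _ q]
        sum_product mult.commute)
  finally show ?thesis .
qed

text \<open>
  Multiplicativity on monomials makes the linear extension a ring homomorphism, and
  its values lie in an integral domain.
\<close>

lemma kernel_lin_ext_primeideal:
  fixes h :: "('v \<Rightarrow>\<^sub>0 nat) \<Rightarrow> 'k::field poly poly"
  assumes one: "h 0 = 1" and mult: "\<And>m m'. h (m + m') = h m * h m'"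
  shows "primeideal {p \<in> carrier (polynomial_ring V). lin_ext h p = 0} (polynomial_ring V)"
proof -
  let ?A = "polynomial_ring V :: ('v, 'k) mpoly ring"
  let ?K = "{p \<in> carrier ?A. lin_ext h p = 0}"
  interpret cring ?A
    by (rule cring_polynomial_ring)
  show ?thesis
  proof (rule primeidealI[OF idealI])
    show "subgroup ?K (add_monoid ?A)"
    proof (rule add.subgroupI)
      have "0 \<in> ?K"
        by (simp add: carrier_polynomial_ring lin_ext_zero)
      then show "?K \<noteq> {}" by blast
      show "\<ominus>\<^bsub>?A\<^esub> p \<in> ?K" if "p \<in> ?K" for p
        using that a_inv_closed[of p] lin_ext_diff[of h 0 p]
        by (simp add: uminus_polynomial_ring lin_ext_zero)
      show "p \<oplus>\<^bsub>?A\<^esub> q \<in> ?K" if "p \<in> ?K" "q \<in> ?K" for p q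
        using that a_closed[of p q] by (simp add: polynomial_ring_simps lin_ext_add)
    qed auto
    show "q \<otimes>\<^bsub>?A\<^esub> p \<in> ?K" "p \<otimes>\<^bsub>?A\<^esub> q \<in> ?K" if "p \<in> ?K" "q \<in> carrier ?A" for p q
      using that m_closed[of p q] m_closed[of q p]
      by (simp_all add: polynomial_ring_simps lin_ext_mult mult)
    have "lin_ext h 1 = 1"
      using lin_ext_single[of h 0 1] by (simp add: one flip: one_pCons)
    then have "1 \<notin> ?K" by simp
    moreover have "1 \<in> carrier ?A"
      using one_closed by (simp add: polynomial_ring_simps)
    ultimately show "carrier ?A \<noteq> ?K" by blast
    show "p \<in> ?K \<or> q \<in> ?K" if "p \<in> carrier ?A" "q \<in> carrier ?A" "p \<otimes>\<^bsub>?A\<^esub> q \<in> ?K" for p q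
      using that by (simp add: polynomial_ring_simps lin_ext_mult mult)
  qed (rule ring_axioms cring_axioms)+
qed

text \<open>
  The monomials that are not \<open>good\<close> go to zero, the others to the monomial in two
  variables with exponents \<open>e\<close> (outer variable) and \<open>w\<close> (inner variable).
\<close>

definition monomial_map ::
  "('m \<Rightarrow> bool) \<Rightarrow> ('m \<Rightarrow> nat) \<Rightarrow> ('m \<Rightarrow> nat) \<Rightarrow> 'm \<Rightarrow> 'k::field poly poly" where
  "monomial_map good e w m = (if good m then monom (monom 1 (w m)) (e m) else 0)"

lemma coeff_lin_ext_monomial_map:
  "coeff (coeff (lin_ext (monomial_map good e w) p) i) j
     = (\<Sum>m \<in> {m \<in> Poly_Mapping.keys p. good m \<and> e m = i \<and> w m = j}. Poly_Mapping.lookup p m)"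
proof -
  have "coeff (coeff (lin_ext (monomial_map good e w) p) i) j
      = (\<Sum>m\<in>Poly_Mapping.keys p.
          if good m \<and> e m = i \<and> w m = j then Poly_Mapping.lookup p m else 0)"
    unfolding lin_ext_def coeff_sum
    by (intro sum.cong) (auto simp: monomial_map_def coeff_monom smult_monom)
  then show ?thesis
    by (simp add: sum.inter_filter)
qed

text \<open>
  The kernel of a monomial map is spanned by the monomials that it kills and by the
  differences of monomials with a common image. Indeed, if a polynomial \<open>p\<close> in the
  kernel contains a monomial with nonzero image, then the terms of \<open>p\<close> over that image
  cancel, so there is a second such monomial; subtracting a multiple of their
  difference removes a term of \<open>p\<close> and adds none.
\<close>

lemma kernel_subset_ideal:
  fixes J :: "('v, 'k::field) mpoly set"
  assumes J: "ideal J (polynomial_ring V)"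
    and bad: "\<And>m. Poly_Mapping.keys m \<subseteq> V \<Longrightarrow> \<not> good m \<Longrightarrow> Poly_Mapping.single m 1 \<in> J"
    and same: "\<And>m m'. Poly_Mapping.keys m \<subseteq> V \<Longrightarrow> Poly_Mapping.keys m' \<subseteq> V \<Longrightarrow>
        good m \<Longrightarrow> good m' \<Longrightarrow> e m = e m' \<Longrightarrow> w m = w m' \<Longrightarrow>
        Poly_Mapping.single m 1 - Poly_Mapping.single m' 1 \<in> J"
  shows "{p \<in> carrier (polynomial_ring V). lin_ext (monomial_map good e w) p = 0} \<subseteq> J"
proof -
  let ?h = "monomial_map good e w :: _ \<Rightarrow> 'k poly poly"
  have scale: "Poly_Mapping.single 0 c * q \<in> J" if "q \<in> J" for q c
    using that by (intro polynomial_ideal_closed[OF J] single_in_carrier) simp_all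
  have mon_mult: "Poly_Mapping.single 0 c * Poly_Mapping.single m 1 = Poly_Mapping.single m c"
    for c :: 'k and m :: "'v \<Rightarrow>\<^sub>0 nat"
    by (simp add: mult_single)
  have "p \<in> J" if "p \<in> carrier (polynomial_ring V)" "lin_ext ?h p = 0" for p
    using that
  proof (induction "card (Poly_Mapping.keys p)" arbitrary: p rule: less_induct)
    case less
    show ?case
    proof (cases "p = 0")
      case True
      then show ?thesis using polynomial_ideal_closed(1)[OF J] by simp
    next
      case False
      then obtain m where m: "m \<in> Poly_Mapping.keys p"
        using keys_eq_empty by blast
      define c where "c = Poly_Mapping.lookup p m"
      have V: "Poly_Mapping.keys m' \<subseteq> V" if "m' \<in> Poly_Mapping.keys p" for m'
        using less.prems(1) that by (simp add: carrier_polynomial_ring)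
      have "\<exists>q\<in>J. lin_ext ?h q = 0 \<and> Poly_Mapping.keys q \<subseteq> Poly_Mapping.keys p
          \<and> Poly_Mapping.lookup q m = c"
      proof (cases "good m")
        case False
        have "Poly_Mapping.single m c \<in> J"
          using scale[OF bad[OF V[OF m] False], of c] by (simp only: mon_mult)
        then show ?thesis
          using m False by (intro bexI[of _ "Poly_Mapping.single m c"])
            (auto simp: lin_ext_single monomial_map_def c_def)
      next
        case True
        \<comment> \<open>The coefficient of the image at \<open>m\<close> vanishes, so another monomial of \<open>p\<close>
          must have the same image.\<close>
        let ?F = "{m' \<in> Poly_Mapping.keys p. good m' \<and> e m' = e m \<and> w m' = w m}"
        have "(\<Sum>m'\<in>?F. Poly_Mapping.lookup p m') = 0"
          using coeff_lin_ext_monomial_map[of good e w p "e m" "w m"] less.prems(2) by simp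
        moreover have "Poly_Mapping.lookup p m \<noteq> 0"
          using m by (simp add: in_keys_iff)
        ultimately have "?F \<noteq> {m}"
          by (metis sum.insert finite.emptyI empty_iff sum.empty add_0_right)
        then obtain m' where m': "m' \<in> Poly_Mapping.keys p" "good m'" "e m' = e m" "w m' = w m"
            "m' \<noteq> m"
          using m True by blast
        let ?q = "Poly_Mapping.single m c - Poly_Mapping.single m' c"
        have "Poly_Mapping.single 0 c * (Poly_Mapping.single m 1 - Poly_Mapping.single m' 1) \<in> J"
          using scale[OF same[OF V[OF m] V[OF m'(1)] True m'(2)]] m' by simp
        then have "?q \<in> J"
          by (simp only: right_diff_distrib mon_mult)
        moreover have "lin_ext ?h ?q = 0"
          using m' True by (simp add: lin_ext_diff lin_ext_single monomial_map_def)
        moreover have "Poly_Mapping.keys ?q \<subseteq> Poly_Mapping.keys p"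
          using m m'(1) keys_diff[of "Poly_Mapping.single m c" "Poly_Mapping.single m' c"]
          by (auto split: if_splits)
        ultimately show ?thesis
          using m' by (intro bexI[of _ ?q]) (auto simp: lookup_minus lookup_single)
      qed
      then obtain q where q: "q \<in> J" "lin_ext ?h q = 0"
          "Poly_Mapping.keys q \<subseteq> Poly_Mapping.keys p" "Poly_Mapping.lookup q m = c"
        by blast
      have sub: "Poly_Mapping.keys (p - q) \<subseteq> Poly_Mapping.keys p - {m}"
        using q keys_diff[of p q] by (auto simp: in_keys_iff lookup_minus c_def)
      have "p - q \<in> J"
      proof (rule less.hyps)
        show "card (Poly_Mapping.keys (p - q)) < card (Poly_Mapping.keys p)"
          using sub m by (intro psubset_card_mono) auto
        show "p - q \<in> carrier (polynomial_ring V)"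
          using sub V unfolding carrier_polynomial_ring by blast
        show "lin_ext ?h (p - q) = 0"
          using less.prems q by (simp add: lin_ext_diff)
      qed
      then show ?thesis
        using polynomial_ideal_closed(2)[OF J _ q(1)] by fastforce
    qed
  qed
  then show ?thesis by blast
qed

section \<open>The ideal of the rational normal curve\<close>

abbreviation pvar :: "'v \<Rightarrow> ('v, 'k::field) mpoly" where
  "pvar v \<equiv> Poly_Mapping.single (Poly_Mapping.single v 1) 1"

text \<open>
  \<open>wsum (\<lambda>_. 1)\<close> is the degree of a monomial, and \<open>wsum id\<close> is the sum of the indices of
  its variables, counted with multiplicity; the latter is called its weight below.
\<close>

definition wsum :: "('v \<Rightarrow> nat) \<Rightarrow> ('v \<Rightarrow>\<^sub>0 nat) \<Rightarrow> nat" where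
  "wsum g m = (\<Sum>v\<in>Poly_Mapping.keys m. g v * Poly_Mapping.lookup m v)"

lemma wsum_zero: "wsum g 0 = 0"
  by (simp add: wsum_def)

lemma wsum_single: "wsum g (Poly_Mapping.single v k) = g v * k"
  by (simp add: wsum_def)

lemma wsum_add: "wsum g (m + m') = wsum g m + wsum g m'"
proof -
  let ?S = "Poly_Mapping.keys m \<union> Poly_Mapping.keys m'"
  have superset: "wsum g x = (\<Sum>v\<in>?S. g v * Poly_Mapping.lookup x v)"
    if "Poly_Mapping.keys x \<subseteq> ?S" for x
    unfolding wsum_def
    by (rule sum.mono_neutral_left) (use that in \<open>auto simp: in_keys_iff\<close>)
  show ?thesis
    using keys_add[of m m'] superset[of "m + m'"] superset[of m] superset[of m']
    by (simp add: lookup_add distrib_left sum.distrib)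
qed

lemma extract_var:
  fixes m :: "'v \<Rightarrow>\<^sub>0 nat"
  assumes "v \<in> Poly_Mapping.keys m"
  obtains m' where "m = Poly_Mapping.single v 1 + m'"
proof
  show "m = Poly_Mapping.single v 1 + (m - Poly_Mapping.single v 1)"
    using assms
    by (intro poly_mapping_eqI) (auto simp: lookup_add lookup_minus lookup_single in_keys_iff when_def)
qed

lemma keys_add_nat:
  "Poly_Mapping.keys (m + m' :: 'v \<Rightarrow>\<^sub>0 nat) = Poly_Mapping.keys m \<union> Poly_Mapping.keys m'"
  by (auto simp: in_keys_iff lookup_add)

lemma pvar_in_carrier: "v \<in> V \<Longrightarrow> pvar v \<in> carrier (polynomial_ring V)"
  by (simp add: carrier_polynomial_ring)

lemma quadric_in_carrier:
  fixes A B C D :: 'v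
  assumes "A \<in> V" "B \<in> V" "C \<in> V" "D \<in> V"
  shows "(pvar A * pvar B - pvar C * pvar D :: ('v, 'k::field) mpoly) \<in> carrier (polynomial_ring V)"
proof -
  have "Poly_Mapping.keys (pvar A * pvar B - pvar C * pvar D :: ('v, 'k) mpoly)
      \<subseteq> Poly_Mapping.keys (pvar A * pvar B :: ('v, 'k) mpoly)
        \<union> Poly_Mapping.keys (pvar C * pvar D :: ('v, 'k) mpoly)"
    by (rule keys_diff)
  also have "\<dots> \<subseteq> {m. Poly_Mapping.keys m \<subseteq> V}"
    using assms by (simp add: mult_single keys_add_nat)
  finally show ?thesis
    unfolding carrier_polynomial_ring by blast
qed

text \<open>
  The hypothesis moves the two indices of a quadratic monomial by one, keeping their
  sum; \<open>k\<close> such moves are chained. Once the indices have passed each other the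
  hypothesis is used with their roles exchanged.
\<close>

lemma quadrics_in_ideal:
  fixes J :: "(nat, 'k::field) mpoly set"
  assumes J: "ideal J (polynomial_ring {l..h})"
    and adj: "\<And>A B. l \<le> A \<Longrightarrow> A \<le> B \<Longrightarrow> B < h \<Longrightarrow>
      pvar A * pvar (Suc B) - pvar (Suc A) * pvar B \<in> J"
  shows "l \<le> A \<Longrightarrow> B \<le> h \<Longrightarrow> A + k \<le> B \<Longrightarrow> pvar A * pvar B - pvar (A + k) * pvar (B - k) \<in> J"
proof (induction k)
  case 0
  then show ?case using polynomial_ideal_closed(1)[OF J] by simp
next
  case (Suc k)
  let ?C = "A + k" and ?D = "B - Suc k"
  have D: "B - k = Suc ?D" using Suc.prems by simp
  have "pvar ?C * pvar (Suc ?D) - pvar (Suc ?C) * pvar ?D \<in> J"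
  proof (cases "?C \<le> ?D")
    case True
    then show ?thesis using Suc.prems by (intro adj) auto
  next
    case False
    then have "pvar ?D * pvar (Suc ?C) - pvar (Suc ?D) * pvar ?C \<in> J"
      using Suc.prems by (intro adj) auto
    from polynomial_ideal_closed(4)[OF J this] show ?thesis
      by (simp add: mult.commute)
  qed
  moreover have "pvar A * pvar B - pvar ?C * pvar (Suc ?D) \<in> J"
    using Suc D by simp
  ultimately have "pvar A * pvar B - pvar ?C * pvar (Suc ?D)
      + (pvar ?C * pvar (Suc ?D) - pvar (Suc ?C) * pvar ?D) \<in> J"
    by (intro polynomial_ideal_closed(2)[OF J])
  then show ?case by simp
qed

text \<open>
  The index \<open>v\<close> is the rounded mean of the indices in \<open>m\<close> and hence depends only on
  degree and weight. If \<open>m\<close> lacks \<open>y\<^sub>v\<close>, then it has an index \<open>A\<close> below \<open>v\<close> and an index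
  \<open>B\<close> above it, and one quadric replaces \<open>y\<^sub>A y\<^sub>B\<close> by \<open>y\<^sub>v y\<^sub>A\<^sub>+\<^sub>B\<^sub>-\<^sub>v\<close>. This makes a common
  variable available to all monomials of the same degree and weight.
\<close>

lemma monomial_congruent_with_mean_variable:
  fixes J :: "(nat, 'k::field) mpoly set"
  assumes J: "ideal J (polynomial_ring {l..h})"
    and adj: "\<And>A B. l \<le> A \<Longrightarrow> A \<le> B \<Longrightarrow> B < h \<Longrightarrow>
      pvar A * pvar (Suc B) - pvar (Suc A) * pvar B \<in> J"
    and m: "Poly_Mapping.keys m \<subseteq> {l..h}" "m \<noteq> 0"
    and v: "v = wsum id m div wsum (\<lambda>_. 1) m"
  obtains m' where "Poly_Mapping.keys m' \<subseteq> {l..h}" "v \<in> {l..h}"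
    "wsum id m = v + wsum id m'" "wsum (\<lambda>_. 1) m = Suc (wsum (\<lambda>_. 1) m')"
    "Poly_Mapping.single m 1 - Poly_Mapping.single (Poly_Mapping.single v 1 + m') 1 \<in> J"
proof (cases "v \<in> Poly_Mapping.keys m")
  case True
  then obtain m' where m': "m = Poly_Mapping.single v 1 + m'"
    by (rule extract_var)
  show ?thesis
  proof (rule that)
    show "Poly_Mapping.keys m' \<subseteq> {l..h}"
      using m m' by (simp add: keys_add_nat)
    show "v \<in> {l..h}" using True m by blast
    show "wsum id m = v + wsum id m'" "wsum (\<lambda>_. 1) m = Suc (wsum (\<lambda>_. 1) m')"
      unfolding m' wsum_add wsum_single by simp_all
    show "Poly_Mapping.single m 1 - Poly_Mapping.single (Poly_Mapping.single v 1 + m') 1 \<in> J"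
      unfolding m' using polynomial_ideal_closed(1)[OF J] by simp
  qed
next
  case False
  let ?deg = "wsum (\<lambda>_. 1) m" and ?wt = "wsum id m"
  obtain u where u: "u \<in> Poly_Mapping.keys m"
    using m(2) keys_eq_empty by blast
  have deg: "?deg > 0"
    unfolding wsum_def using u
    by (intro sum_pos2[OF _ u]) (auto simp: in_keys_iff)
  have "v * ?deg \<le> ?wt" "?wt < Suc v * ?deg"
    unfolding v using deg dividend_less_div_times[OF deg, of ?wt] by (simp_all add: add.commute)
  have "\<exists>A\<in>Poly_Mapping.keys m. A < v"
  proof (rule ccontr)
    assume "\<not> ?thesis"
    then have "Suc v \<le> A" if "A \<in> Poly_Mapping.keys m" for A
      using False that by (metis Suc_leI linorder_neqE_nat)
    then have "Suc v * ?deg \<le> ?wt"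
      unfolding wsum_def sum_distrib_left
      by (intro sum_mono) (auto simp del: mult_Suc intro!: mult_right_mono)
    with \<open>?wt < Suc v * ?deg\<close> show False by simp
  qed
  then obtain A where A: "A \<in> Poly_Mapping.keys m" "A < v" by blast
  have "\<exists>B\<in>Poly_Mapping.keys m. v < B"
  proof (rule ccontr)
    assume "\<not> ?thesis"
    then have less: "B < v" if "B \<in> Poly_Mapping.keys m" for B
      using False that by (metis linorder_neqE_nat)
    have "?wt < v * ?deg"
      unfolding wsum_def sum_distrib_left
      using u less by (intro sum_strict_mono) (auto simp: in_keys_iff)
    with \<open>v * ?deg \<le> ?wt\<close> show False by simp
  qed
  then obtain B where B: "B \<in> Poly_Mapping.keys m" "v < B" by blast
  obtain m1 where m1: "m = Poly_Mapping.single A 1 + m1"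
    using A(1) by (rule extract_var)
  have "B \<in> Poly_Mapping.keys m1"
    using B A unfolding m1 by (simp add: keys_add_nat)
  then obtain m2 where m2: "m1 = Poly_Mapping.single B 1 + m2"
    by (rule extract_var)
  let ?D = "B - (v - A)"
  have AB: "l \<le> A" "B \<le> h" using A B m by auto
  show ?thesis
  proof (rule that[of "Poly_Mapping.single ?D 1 + m2"])
    show "Poly_Mapping.keys (Poly_Mapping.single ?D 1 + m2) \<subseteq> {l..h}"
      using m(1) A B AB unfolding m1 m2 by (auto simp: keys_add_nat)
    show "v \<in> {l..h}" using A B AB by simp
    show "?wt = v + wsum id (Poly_Mapping.single ?D 1 + m2)"
      unfolding m1 m2 wsum_add wsum_single using A B by simp
    show "?deg = Suc (wsum (\<lambda>_. 1) (Poly_Mapping.single ?D 1 + m2))"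
      unfolding m1 m2 wsum_add wsum_single by simp
    have "pvar A * pvar B - pvar (A + (v - A)) * pvar (B - (v - A)) \<in> J"
      using A B AB by (intro quadrics_in_ideal[OF J adj]) auto
    then have "Poly_Mapping.single m2 1 * (pvar A * pvar B - pvar v * pvar ?D) \<in> J"
      using m(1) A(2) unfolding m1 m2
      by (intro polynomial_ideal_closed(5)[OF J _ single_in_carrier]) (auto simp: keys_add_nat)
    then show "Poly_Mapping.single m 1
        - Poly_Mapping.single (Poly_Mapping.single v 1 + (Poly_Mapping.single ?D 1 + m2)) 1 \<in> J"
      unfolding m1 m2 by (simp add: right_diff_distrib mult_single add_ac)
  qed
qed

text \<open>
  Both monomials are congruent to multiples of the same variable, which can be
  cancelled: the remaining factors again agree in degree and weight.
\<close>

lemma monomials_congruent: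
  fixes J :: "(nat, 'k::field) mpoly set"
  assumes J: "ideal J (polynomial_ring {l..h})"
    and adj: "\<And>A B. l \<le> A \<Longrightarrow> A \<le> B \<Longrightarrow> B < h \<Longrightarrow>
      pvar A * pvar (Suc B) - pvar (Suc A) * pvar B \<in> J"
  shows "Poly_Mapping.keys m \<subseteq> {l..h} \<Longrightarrow> Poly_Mapping.keys m' \<subseteq> {l..h} \<Longrightarrow>
    wsum (\<lambda>_. 1) m = wsum (\<lambda>_. 1) m' \<Longrightarrow> wsum id m = wsum id m' \<Longrightarrow>
    Poly_Mapping.single m 1 - Poly_Mapping.single m' 1 \<in> J"
proof (induction "wsum (\<lambda>_. 1) m" arbitrary: m m')
  case 0
  have "x = 0" if "wsum (\<lambda>_. 1) x = 0" for x :: "nat \<Rightarrow>\<^sub>0 nat"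
    using that by (intro poly_mapping_eqI) (auto simp: wsum_def in_keys_iff)
  then have "m = 0" "m' = 0" using 0 by simp_all
  then show ?case using polynomial_ideal_closed(1)[OF J] by simp
next
  case (Suc k)
  have nz: "m \<noteq> 0" "m' \<noteq> 0" using Suc.hyps(2) Suc.prems(3) by (auto simp: wsum_def)
  define v where "v = wsum id m div wsum (\<lambda>_. 1) m"
  have v': "v = wsum id m' div wsum (\<lambda>_. 1) m'"
    using Suc.prems(3,4) by (simp only: v_def)
  obtain m1 where m1: "Poly_Mapping.keys m1 \<subseteq> {l..h}" "v \<in> {l..h}"
    "wsum id m = v + wsum id m1" "wsum (\<lambda>_. 1) m = Suc (wsum (\<lambda>_. 1) m1)"
    "Poly_Mapping.single m 1 - Poly_Mapping.single (Poly_Mapping.single v 1 + m1) 1 \<in> J"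
    using monomial_congruent_with_mean_variable[OF J adj Suc.prems(1) nz(1) v_def] by blast
  obtain m2 where m2: "Poly_Mapping.keys m2 \<subseteq> {l..h}"
    "wsum id m' = v + wsum id m2" "wsum (\<lambda>_. 1) m' = Suc (wsum (\<lambda>_. 1) m2)"
    "Poly_Mapping.single m' 1 - Poly_Mapping.single (Poly_Mapping.single v 1 + m2) 1 \<in> J"
    using monomial_congruent_with_mean_variable[OF J adj Suc.prems(2) nz(2) v'] by blast
  have "Poly_Mapping.single m1 1 - Poly_Mapping.single m2 1 \<in> J"
    using Suc m1 m2 by (intro Suc.hyps(1)) auto
  then have "pvar v * (Poly_Mapping.single m1 1 - Poly_Mapping.single m2 1) \<in> J"
    using m1(2) by (intro polynomial_ideal_closed(5)[OF J] pvar_in_carrier)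
  then have "Poly_Mapping.single (Poly_Mapping.single v 1 + m1) 1
      - Poly_Mapping.single (Poly_Mapping.single v 1 + m2) 1 \<in> J"
    by (simp add: right_diff_distrib mult_single)
  then have "Poly_Mapping.single m 1 - Poly_Mapping.single (Poly_Mapping.single v 1 + m1) 1
      + (Poly_Mapping.single (Poly_Mapping.single v 1 + m1) 1
         - Poly_Mapping.single (Poly_Mapping.single v 1 + m2) 1)
      - (Poly_Mapping.single m' 1 - Poly_Mapping.single (Poly_Mapping.single v 1 + m2) 1) \<in> J"
    by (intro polynomial_ideal_closed(3)[OF J polynomial_ideal_closed(2)[OF J]] m1(5) m2(4))
  then show ?case by simp
qed

text \<open>
  The kernel of \<open>y\<^sub>v \<mapsto> S T\<^sup>v\<close>, that is, the homogeneous ideal of the rational normal curve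
  with coordinates indexed from \<open>l\<close> to \<open>h\<close>.
\<close>

definition curve_ideal :: "nat \<Rightarrow> nat \<Rightarrow> (nat, 'k::field) mpoly set" where
  "curve_ideal l h = {p \<in> carrier (polynomial_ring {l..h}).
     lin_ext (monomial_map (\<lambda>_. True) (wsum (\<lambda>_. 1)) (wsum id)) p = 0}"

lemma curve_ideal_prime: "primeideal (curve_ideal l h) (polynomial_ring {l..h})"
  unfolding curve_ideal_def
  by (rule kernel_lin_ext_primeideal)
    (simp_all add: monomial_map_def wsum_zero wsum_add mult_monom)

lemma curve_ideal_least:
  assumes "ideal J (polynomial_ring {l..h})"
    and "\<And>A B. l \<le> A \<Longrightarrow> A \<le> B \<Longrightarrow> B < h \<Longrightarrow>
      pvar A * pvar (Suc B) - pvar (Suc A) * pvar B \<in> J"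
  shows "curve_ideal l h \<subseteq> J"
  unfolding curve_ideal_def
  by (rule kernel_subset_ideal[OF assms(1)])
    (use monomials_congruent[OF assms] in auto)

lemma quadric_in_curve_ideal_iff:
  assumes "A \<in> {l..h}" "B \<in> {l..h}" "C \<in> {l..h}" "D \<in> {l..h}"
  shows "(pvar A * pvar B - pvar C * pvar D :: (nat, 'k::field) mpoly) \<in> curve_ideal l h
    \<longleftrightarrow> A + B = C + D"
proof -
  let ?h = "monomial_map (\<lambda>_. True) (wsum (\<lambda>_. 1)) (wsum id) :: _ \<Rightarrow> 'k poly poly"
  have image: "lin_ext ?h (pvar a * pvar b) = monom (monom 1 (a + b)) 2" for a b
    by (simp add: mult_single lin_ext_single monomial_map_def wsum_add wsum_single smult_monom
        numeral_2_eq_2)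
  show ?thesis
    using quadric_in_carrier[OF assms, where 'k = 'k]
    unfolding curve_ideal_def mem_Collect_eq lin_ext_diff image
    by (auto simp: monom_eq_iff')
qed

section \<open>The ideal of the line joining the end points of the curve\<close>

text \<open>
  The kernel of the substitution that keeps \<open>y\<^sub>l\<close> and \<open>y\<^sub>h\<close> and sends all other variables
  to zero. As a kernel it is visibly prime; that those variables suffice to
  generate it is the content of \<open>line_ideal_least\<close> below.
\<close>

definition line_ideal :: "nat \<Rightarrow> nat \<Rightarrow> (nat, 'k::field) mpoly set" where
  "line_ideal l h = {p \<in> carrier (polynomial_ring {l..h}).
     lin_ext (monomial_map (\<lambda>m. Poly_Mapping.keys m \<subseteq> {l, h})
       (\<lambda>m. Poly_Mapping.lookup m l) (\<lambda>m. Poly_Mapping.lookup m h)) p = 0}"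

lemma line_ideal_prime: "primeideal (line_ideal l h) (polynomial_ring {l..h})"
  unfolding line_ideal_def
  by (rule kernel_lin_ext_primeideal)
    (auto simp add: monomial_map_def lookup_add mult_monom keys_add_nat)

lemma single_in_line_ideal_iff:
  assumes "Poly_Mapping.keys m \<subseteq> {l..h}"
  shows "Poly_Mapping.single m (1::'k::field) \<in> line_ideal l h \<longleftrightarrow> \<not> Poly_Mapping.keys m \<subseteq> {l, h}"
  using assms
  by (simp add: line_ideal_def lin_ext_single monomial_map_def carrier_polynomial_ring monom_eq_0_iff)

lemma line_ideal_least:
  fixes J :: "(nat, 'k::field) mpoly set"
  assumes J: "ideal J (polynomial_ring {l..h})"
    and vars: "\<And>v. l < v \<Longrightarrow> v < h \<Longrightarrow> pvar v \<in> J"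
  shows "line_ideal l h \<subseteq> J"
  unfolding line_ideal_def
proof (rule kernel_subset_ideal[OF J])
  fix m :: "nat \<Rightarrow>\<^sub>0 nat"
  assume m: "Poly_Mapping.keys m \<subseteq> {l..h}" "\<not> Poly_Mapping.keys m \<subseteq> {l, h}"
  then obtain v where v: "v \<in> Poly_Mapping.keys m" "v \<noteq> l" "v \<noteq> h" by blast
  then obtain m' where m': "m = Poly_Mapping.single v 1 + m'"
    by (blast elim: extract_var)
  have "Poly_Mapping.single m' 1 * pvar v \<in> J"
    using m(1) v unfolding m'
    by (intro polynomial_ideal_closed(5)[OF J vars single_in_carrier]) (auto simp: keys_add_nat)
  then show "Poly_Mapping.single m 1 \<in> J"
    by (simp add: m' mult_single add.commute)
next
  fix m m' :: "nat \<Rightarrow>\<^sub>0 nat"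
  assume m: "Poly_Mapping.keys m \<subseteq> {l, h}" "Poly_Mapping.keys m' \<subseteq> {l, h}"
    "Poly_Mapping.lookup m l = Poly_Mapping.lookup m' l"
    "Poly_Mapping.lookup m h = Poly_Mapping.lookup m' h"
  have "m = m'"
  proof (rule poly_mapping_eqI)
    show "Poly_Mapping.lookup m v = Poly_Mapping.lookup m' v" for v
    proof (cases "v \<in> {l, h}")
      case False
      then have "v \<notin> Poly_Mapping.keys m" "v \<notin> Poly_Mapping.keys m'"
        using m(1,2) by blast+
      then show ?thesis by (simp add: in_keys_iff)
    qed (use m(3,4) in auto)
  qed
  then show "Poly_Mapping.single m 1 - Poly_Mapping.single m' 1 \<in> J"
    using polynomial_ideal_closed(1)[OF J] by simp
qed

section \<open>Primes containing the consecutive minors\<close>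

text \<open>
  Modulo the prime \<open>Q\<close> the hypothesis says \<open>y\<^sub>c y\<^sub>c\<^sub>+\<^sub>2 = y\<^sub>c\<^sub>+\<^sub>1\<^sup>2\<close>. If some \<open>y\<^sub>s\<close> vanishes, then so
  does each of its neighbours other than \<open>y\<^sub>l\<close> and \<open>y\<^sub>h\<close>, which are never a middle
  term; hence all interior variables lie in \<open>Q\<close>. If no \<open>y\<^sub>s\<close> vanishes, then the
  variables form a geometric progression in a domain, so that all adjacent minors vanish.
\<close>

lemma prime_over_consecutive_minors:
  fixes Q :: "(nat, 'k::field) mpoly set"
  assumes Q: "primeideal Q (polynomial_ring {l..h})"
    and minors: "\<And>c. l \<le> c \<Longrightarrow> c + 2 \<le> h \<Longrightarrow>
      pvar c * pvar (c + 2) - pvar (c + 1) * pvar (c + 1) \<in> Q"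
  shows "curve_ideal l h \<subseteq> Q \<or> line_ideal l h \<subseteq> Q"
proof -
  have J: "ideal Q (polynomial_ring {l..h})"
    using Q by (simp add: primeideal.axioms(1))
  have pv: "pvar c \<in> carrier (polynomial_ring {l..h})" if "l \<le> c" "c \<le> h" for c
    using that by (intro pvar_in_carrier) simp
  have mid: "pvar (c + 1) \<in> Q"
    if c: "l \<le> c" "c + 2 \<le> h" and "pvar c \<in> Q \<or> pvar (c + 2) \<in> Q" for c
  proof -
    have "pvar c * pvar (c + 2) \<in> Q"
      using that polynomial_ideal_closed(5)[OF J, of "pvar c" "pvar (c + 2)"]
        polynomial_ideal_closed(5)[OF J, of "pvar (c + 2)" "pvar c"] pv[of c] pv[of "c + 2"]
      by (auto simp: mult.commute)
    then have "pvar (c + 1) * pvar (c + 1) \<in> Q"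
      using polynomial_ideal_closed(3)[OF J _ minors[OF c]] by fastforce
    then show ?thesis
      using primeideal_mult_cases[OF Q] pv[of "c + 1"] c by fastforce
  qed
  show ?thesis
  proof (cases "\<exists>s\<in>{l..h}. pvar s \<in> Q")
    case True
    then obtain s where s: "l \<le> s" "s \<le> h" "pvar s \<in> Q" by auto
    have up: "pvar v \<in> Q" if "s \<le> v" "v < h" for v
      using that
    proof (induction v rule: dec_induct)
      case base
      show ?case by (rule s)
    next
      case (step v)
      then show ?case using mid[of v] s by simp
    qed
    have down: "pvar v \<in> Q" if "v \<le> s" "l < v" for v
      using that
    proof (induction v rule: inc_induct)
      case base
      show ?case by (rule s)
    next
      case (step v)
      then show ?case using mid[of "v - 1"] s by simp
    qed
    have "pvar v \<in> Q" if "l < v" "v < h" for v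
      using that up[of v] down[of v] by (cases "s \<le> v") auto
    then show ?thesis using line_ideal_least[OF J] by blast
  next
    case False
    then have nz: "pvar s \<notin> Q" if "l \<le> s" "s \<le> h" for s using that by auto
    have adj: "pvar A * pvar (Suc B) - pvar (Suc A) * pvar B \<in> Q"
      if "l \<le> A" "A \<le> B" "B < h" for A B
      using that(2,3)
    proof (induction B rule: dec_induct)
      case base
      then show ?case using polynomial_ideal_closed(1)[OF J] by (simp add: mult.commute)
    next
      case (step B)
      \<comment> \<open>The identity \<open>?x + ?y = y\<^sub>B ?z\<close> cross-multiplies two equal quotients of
        neighbours; \<open>y\<^sub>B\<close> can then be cancelled.\<close>
      let ?x = "pvar A * (pvar B * pvar (B + 2) - pvar (B + 1) * pvar (B + 1))"
      let ?y = "pvar (B + 1) * (pvar A * pvar (Suc B) - pvar (Suc A) * pvar B)"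
      let ?z = "pvar A * pvar (Suc (Suc B)) - pvar (Suc A) * pvar (Suc B) :: (nat, 'k) mpoly"
      have mem: "?x \<in> Q" "?y \<in> Q"
        using that(1) step
        by (intro polynomial_ideal_closed(5)[OF J] minors pv step.IH; simp)+
      have "?x + ?y = pvar B * ?z"
        by (simp add: algebra_simps)
      then have "pvar B * ?z \<in> Q"
        using polynomial_ideal_closed(2)[OF J mem] by simp
      moreover have "?z \<in> carrier (polynomial_ring {l..h})"
        using that(1) step.hyps step.prems by (intro quadric_in_carrier) auto
      ultimately show ?case
        using primeideal_mult_cases[OF Q] pv[of B] nz[of B] that(1) step by fastforce
    qed
    then show ?thesis using curve_ideal_least[OF J] by blast
  qed
qed

section \<open>Component sums of index tuples\<close>

lemma sum_fun_upd_nat: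
  fixes a :: "'i \<Rightarrow> nat"
  assumes "finite S" "i \<in> S"
  shows "sum (a(i := v)) S + a i = sum a S + v"
proof -
  have "sum (a(i := v)) (S - {i}) = sum a (S - {i})"
    by (intro sum.cong) auto
  then show ?thesis
    using sum.remove[OF assms, of a] sum.remove[OF assms, of "a(i := v)"] by simp
qed

lemma box_contains_all_sums:
  fixes lo hi :: "'i \<Rightarrow> nat"
  assumes "finite S" "\<And>i. i \<in> S \<Longrightarrow> lo i \<le> hi i" "sum lo S \<le> s" "s \<le> sum hi S"
  shows "\<exists>a\<in>(\<Pi>\<^sub>E i\<in>S. {lo i..hi i}). sum a S = s"
  using assms
proof (induction S arbitrary: s rule: finite_induct)
  case empty
  then show ?case by simp
next
  case (insert x F)
  \<comment> \<open>The least admissible component that leaves no more than the others can make up;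
    truncated subtraction covers the case in which they can make up everything.\<close>
  define v where "v = max (lo x) (s - sum hi F)"
  have le: "sum lo F \<le> sum hi F"
    using insert.prems(1) by (intro sum_mono) auto
  have v: "lo x \<le> v" "v \<le> hi x" "v \<le> s" "sum lo F \<le> s - v" "s - v \<le> sum hi F"
    using insert.prems(1)[of x] insert.prems(2,3) insert.hyps le by (auto simp: v_def)
  then obtain a where a: "a \<in> (\<Pi>\<^sub>E i\<in>F. {lo i..hi i})" "sum a F = s - v"
    using insert.IH[of "s - v"] insert.prems(1) by auto
  have "sum (a(x := v)) F = sum a F"
    using insert.hyps(2) by (intro sum.cong) auto
  then have "sum (a(x := v)) (insert x F) = s"
    using insert.hyps a(2) v(3) by simp
  moreover have "a(x := v) \<in> (\<Pi>\<^sub>E i\<in>insert x F. {lo i..hi i})"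
    using a(1) v(1,2) insert.hyps(2) by (auto simp: PiE_iff extensional_def)
  ultimately show ?case by blast
qed

lemma xvar_eq_pvar: "xvar n a = pvar (sum a {1..n})"
  by (simp add: xvar_def)

lemma exists_index_with_sum:
  assumes "\<And>i. i \<in> {1..n} \<Longrightarrow> 1 \<le> r i" "n \<le> s" "s \<le> sum r {1..n}"
  obtains a where "a \<in> index_set n r" "sum a {1..n} = s"
proof -
  have "\<exists>a\<in>(\<Pi>\<^sub>E i\<in>{1..n}. {1..r i}). sum a {1..n} = s"
    by (rule box_contains_all_sums[OF finite_atLeastAtMost assms(1) _ assms(3)])
      (use assms(2) in simp_all)
  then show ?thesis
    using that unfolding index_set_def by blast
qed

lemma index_set_bounds:
  assumes "a \<in> index_set n r" "i \<in> {1..n}"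
  shows "1 \<le> a i" "a i \<le> r i"
  using assms by (auto simp: index_set_def PiE_iff)

lemma sum_in_range:
  assumes "a \<in> index_set n r"
  shows "sum a {1..n} \<in> {n..sum r {1..n}}"
proof -
  have "sum (\<lambda>_. 1) {1..n} \<le> sum a {1..n}" "sum a {1..n} \<le> sum r {1..n}"
    by (intro sum_mono index_set_bounds[OF assms]; assumption)+
  then show ?thesis by simp
qed

lemma eq_ones_if_sum_minimal:
  assumes "a \<in> index_set n r" "sum a {1..n} = n"
  shows "a = (\<lambda>i\<in>{1..n}. 1)"
proof
  fix i
  have "1 = a i" if "i \<in> {1..n}"
    by (rule sum_mono_inv[of "\<lambda>_. 1" "{1..n}" a]) (use that index_set_bounds[OF assms(1)] assms(2) in auto)
  then show "a i = (\<lambda>i\<in>{1..n}. 1) i"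
    using assms(1) by (auto simp: index_set_def PiE_iff extensional_def)
qed

lemma eq_r_if_sum_maximal:
  assumes "a \<in> index_set n r" "sum a {1..n} = sum r {1..n}"
  shows "a = (\<lambda>i\<in>{1..n}. r i)"
proof
  fix i
  have "a i = r i" if "i \<in> {1..n}"
    by (rule sum_mono_inv[of a "{1..n}" r]) (use that index_set_bounds[OF assms(1)] assms(2) in auto)
  then show "a i = (\<lambda>i\<in>{1..n}. r i) i"
    using assms(1) by (auto simp: index_set_def PiE_iff extensional_def)
qed

lemma sw_in_index_set:
  "a \<in> index_set n r \<Longrightarrow> b \<in> index_set n r \<Longrightarrow> i \<in> {1..n} \<Longrightarrow> sw i a b \<in> index_set n r"
  unfolding sw_def index_set_def by (auto simp: PiE_iff extensional_def)

lemma d_sw: "d n (sw i a b) (sw i b a) = d n a b"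
  unfolding d_def sw_def by (rule arg_cong[of _ _ card]) auto

lemma R_eq_polynomial_ring:
  assumes "\<And>i. i \<in> {1..n} \<Longrightarrow> r i \<ge> 1"
  shows "R n r = polynomial_ring {n..sum r {1..n}}"
proof -
  have "s \<in> (\<lambda>a. sum a {1..n}) ` index_set n r" if s: "s \<in> {n..sum r {1..n}}" for s
  proof -
    have "n \<le> s" "s \<le> sum r {1..n}" using s by simp_all
    then obtain a where "a \<in> index_set n r" "sum a {1..n} = s"
      using exists_index_with_sum[of n r s, OF assms] by blast
    then show ?thesis by blast
  qed
  then have "(\<lambda>a. sum a {1..n}) ` index_set n r = {n..sum r {1..n}}"
    using sum_in_range by blast
  then show ?thesis by (simp add: R_def)
qed

section \<open>The generators as quadrics\<close>

lemma f_eq_quadric: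
  "f n i a b = pvar (sum a {1..n}) * pvar (sum b {1..n})
     - pvar (sum (sw i a b) {1..n}) * pvar (sum (sw i b a) {1..n})"
  by (simp only: f_def xvar_eq_pvar)

text \<open>
  Exchanging a component between two tuples preserves the total of their sums.
\<close>

lemma f_in_curve_ideal:
  assumes "a \<in> index_set n r" "b \<in> index_set n r" "i \<in> {1..n}"
  shows "f n i a b \<in> curve_ideal n (sum r {1..n})"
proof -
  have "sum (sw i a b) {1..n} + a i = sum a {1..n} + b i"
    "sum (sw i b a) {1..n} + b i = sum b {1..n} + a i"
    unfolding sw_def using assms(3) by (intro sum_fun_upd_nat; simp)+
  then have "sum a {1..n} + sum b {1..n} = sum (sw i a b) {1..n} + sum (sw i b a) {1..n}"
    by linarith
  then show ?thesis
    unfolding f_eq_quadric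
    by (subst quadric_in_curve_ideal_iff) (intro sum_in_range sw_in_index_set assms)+
qed

text \<open>
  The only variables outside the line ideal belong to the two extreme tuples, which
  differ in all \<open>n \<ge> 3\<close> places; so two tuples at distance two cannot both be extreme.
\<close>

lemma xvar_mult_in_line_ideal:
  assumes n: "n \<ge> 3" and r: "\<And>i. i \<in> {1..n} \<Longrightarrow> r i \<ge> 2"
    and a: "a \<in> index_set n r" and b: "b \<in> index_set n r" and dist: "d n a b = 2"
  shows "(xvar n a * xvar n b :: (nat, 'k::field) mpoly) \<in> line_ideal n (sum r {1..n})"
proof -
  let ?h = "sum r {1..n}"
  have "\<not> {sum a {1..n}, sum b {1..n}} \<subseteq> {n, ?h}"
  proof
    assume "{sum a {1..n}, sum b {1..n}} \<subseteq> {n, ?h}"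
    then have "sum a {1..n} = n \<or> sum a {1..n} = ?h" "sum b {1..n} = n \<or> sum b {1..n} = ?h"
      by simp_all
    then have "a = (\<lambda>i\<in>{1..n}. 1) \<or> a = (\<lambda>i\<in>{1..n}. r i)"
      "b = (\<lambda>i\<in>{1..n}. 1) \<or> b = (\<lambda>i\<in>{1..n}. r i)"
      using eq_ones_if_sum_minimal[OF a] eq_r_if_sum_maximal[OF a] eq_ones_if_sum_minimal[OF b] eq_r_if_sum_maximal[OF b]
      by blast+
    moreover have "a \<noteq> b"
      using dist by (auto simp: d_def)
    ultimately have ab: "a = (\<lambda>i\<in>{1..n}. 1) \<and> b = (\<lambda>i\<in>{1..n}. r i)
        \<or> a = (\<lambda>i\<in>{1..n}. r i) \<and> b = (\<lambda>i\<in>{1..n}. 1)"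
      by blast
    have "a i \<noteq> b i" if "i \<in> {1..n}" for i
      using ab r[OF that] that by auto
    then have "{i \<in> {1..n}. a i \<noteq> b i} = {1..n}"
      by blast
    then show False
      using dist n by (simp add: d_def)
  qed
  then have "Poly_Mapping.single (Poly_Mapping.single (sum a {1..n}) 1
      + Poly_Mapping.single (sum b {1..n}) 1) (1::'k) \<in> line_ideal n ?h"
    using sum_in_range[OF a] sum_in_range[OF b]
    by (subst single_in_line_ideal_iff) (auto simp: keys_add_nat)
  then show ?thesis
    by (simp add: xvar_eq_pvar mult_single)
qed

lemma f_in_line_ideal:
  assumes "n \<ge> 3" "\<And>i. i \<in> {1..n} \<Longrightarrow> r i \<ge> 2"
    and "a \<in> index_set n r" "b \<in> index_set n r" "d n a b = 2" "i \<in> {1..n}"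
  shows "(f n i a b :: (nat, 'k::field) mpoly) \<in> line_ideal n (sum r {1..n})"
proof -
  have J: "ideal (line_ideal n (sum r {1..n}) :: (nat, 'k) mpoly set)
      (polynomial_ring {n..sum r {1..n}})"
    using line_ideal_prime by (rule primeideal.axioms(1))
  show ?thesis
    unfolding f_def
    by (intro polynomial_ideal_closed(3)[OF J] xvar_mult_in_line_ideal sw_in_index_set assms)
      (simp_all add: d_sw assms)
qed

text \<open>
  Two tuples that differ by one in exactly the components \<open>t\<close> and \<open>j\<close> give a consecutive
  minor, and lowering the bounds of these two components by one leaves enough room to
  realise every \<open>c\<close>.
\<close>

lemma consecutive_minor_is_generator:
  assumes n: "n \<ge> 2" and r: "\<And>i. i \<in> {1..n} \<Longrightarrow> r i \<ge> 2" and t: "t \<in> {1..n}"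
    and c: "n \<le> c" "c + 2 \<le> sum r {1..n}"
  obtains a b where "a \<in> index_set n r" "b \<in> index_set n r" "d n a b = 2"
    "f n t a b = pvar c * pvar (c + 2) - pvar (c + 1) * pvar (c + 1)"
proof -
  define j where "j = (if t = 1 then 2 else 1 :: nat)"
  have j: "j \<in> {1..n}" "j \<noteq> t" using n by (auto simp: j_def)
  define hi where "hi = r(t := r t - 1, j := r j - 1)"
  have "sum (r(t := r t - 1)) {1..n} + r t = sum r {1..n} + (r t - 1)"
    "sum hi {1..n} + (r(t := r t - 1)) j = sum (r(t := r t - 1)) {1..n} + (r j - 1)"
    unfolding hi_def using t j by (intro sum_fun_upd_nat; simp)+
  then have "c \<le> sum hi {1..n}"
    using c r[OF t] r[OF j(1)] j by simp
  moreover have "1 \<le> hi i" if "i \<in> {1..n}" for i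
    using r[OF that] by (auto simp: hi_def)
  ultimately obtain a where a: "a \<in> index_set n hi" "sum a {1..n} = c"
    using exists_index_with_sum[of n hi c] c(1) by blast
  note a_le = index_set_bounds[OF a(1)]
  define b where "b = a(t := a t + 1, j := a j + 1)"
  have hi_r: "hi i \<le> r i" for i by (simp add: hi_def)
  show ?thesis
  proof (rule that)
    show "a \<in> index_set n r"
      using a(1) hi_r unfolding index_set_def PiE_iff by (fastforce intro: order_trans)
    then show "b \<in> index_set n r"
      using a_le[OF t] a_le[OF j(1)] r[OF t] r[OF j(1)] t j
      unfolding index_set_def b_def by (auto simp: PiE_iff extensional_def hi_def)
    have "{i \<in> {1..n}. a i \<noteq> b i} = {t, j}"
      using t j by (auto simp: b_def)
    then show "d n a b = 2"
      using j by (simp add: d_def)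
    have sa: "sum (a(t := a t + 1)) {1..n} + a t = sum a {1..n} + (a t + 1)"
      using t by (intro sum_fun_upd_nat) auto
    have sb: "sum b {1..n} + (a(t := a t + 1)) j = sum (a(t := a t + 1)) {1..n} + (a j + 1)"
      unfolding b_def using j by (intro sum_fun_upd_nat) auto
    have sb': "sum (b(t := a t)) {1..n} + b t = sum b {1..n} + a t"
      using t by (intro sum_fun_upd_nat) auto
    have swab: "sw t a b = a(t := a t + 1)" and swba: "sw t b a = b(t := a t)" and bt: "b t = a t + 1"
      using j by (auto simp: sw_def b_def)
    have "sum (sw t a b) {1..n} = c + 1" "sum b {1..n} = c + 2" "sum (sw t b a) {1..n} = c + 1"
      using sa sb sb' a(2) j(2) unfolding swab swba bt by simp_all
    then show "f n t a b = pvar c * pvar (c + 2) - pvar (c + 1) * pvar (c + 1)"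
      by (simp only: f_eq_quadric a(2))
  qed
qed

text \<open>
  Splitting a tuple into its \<open>t\<close>-th component and the rest exhibits the variables as
  the entries of a Hankel matrix, with \<open>r t\<close> rows (for the component) and one column for
  each sum of the rest. Exchanging the \<open>t\<close>-th components then produces a 2-minor. The
  column index \<open>p\<close> is the sum of the tuple whose \<open>t\<close>-th component is \<open>1\<close>, and the
  component itself is \<open>Suc u\<close>.
\<close>

lemma hankel_minor_is_generator:
  assumes r: "\<And>i. i \<in> {1..n} \<Longrightarrow> r i \<ge> 1" and t: "t \<in> {1..n}"
    and u: "u < r t" and v: "v < r t"
    and p: "n \<le> p" "p + r t \<le> Suc (sum r {1..n})"
    and q: "n \<le> q" "q + r t \<le> Suc (sum r {1..n})"
  obtains a b where "a \<in> index_set n r" "b \<in> index_set n r"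
    "f n t a b = pvar (p + u) * pvar (q + v) - pvar (p + v) * pvar (q + u)"
proof -
  have column: "\<exists>a. a \<in> index_set n r \<and> a t = 1 \<and> sum a {1..n} = s"
    if s: "n \<le> s" "s + r t \<le> Suc (sum r {1..n})" for s
  proof -
    have "sum (r(t := 1)) {1..n} + r t = sum r {1..n} + 1"
      using t by (intro sum_fun_upd_nat) auto
    then have "s \<le> sum (r(t := 1)) {1..n}"
      using s by simp
    moreover have "1 \<le> (r(t := 1)) i" if "i \<in> {1..n}" for i
      using r[OF that] by simp
    ultimately obtain a where a: "a \<in> index_set n (r(t := 1))" "sum a {1..n} = s"
      using exists_index_with_sum[of n "r(t := 1)" s] s(1) by blast
    note le = index_set_bounds[OF a(1)]
    have "a t = 1"
      using le[OF t] by simp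
    moreover have "a i \<le> r i" if "i \<in> {1..n}" for i
      using le[OF that] r[OF that] by (cases "i = t") auto
    ultimately show ?thesis
      using a le(1) by (auto simp: index_set_def PiE_iff)
  qed
  obtain a where a: "a \<in> index_set n r" "a t = 1" "sum a {1..n} = p"
    using column[OF p] by blast
  obtain b where b: "b \<in> index_set n r" "b t = 1" "sum b {1..n} = q"
    using column[OF q] by blast
  have upd: "x(t := Suc k) \<in> index_set n r" "sum (x(t := Suc k)) {1..n} = s + k"
    if "x \<in> index_set n r" "x t = 1" "sum x {1..n} = s" "k < r t" for x k s
  proof -
    show "x(t := Suc k) \<in> index_set n r"
      using that t by (auto simp: index_set_def PiE_iff extensional_def)
    have "sum (x(t := Suc k)) {1..n} + x t = sum x {1..n} + Suc k"
      using t by (intro sum_fun_upd_nat) auto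
    then show "sum (x(t := Suc k)) {1..n} = s + k"
      using that by simp
  qed
  show ?thesis
  proof (rule that)
    show "a(t := Suc u) \<in> index_set n r" "b(t := Suc v) \<in> index_set n r"
      using a b u v by (auto intro: upd(1))
    have "sw t (a(t := Suc u)) (b(t := Suc v)) = a(t := Suc v)"
      "sw t (b(t := Suc v)) (a(t := Suc u)) = b(t := Suc u)"
      by (simp_all add: sw_def)
    then show "f n t (a(t := Suc u)) (b(t := Suc v))
        = pvar (p + u) * pvar (q + v) - pvar (p + v) * pvar (q + u)"
      unfolding f_eq_quadric by (simp only: upd(2)[OF a u] upd(2)[OF a v] upd(2)[OF b u] upd(2)[OF b v])
  qed
qed

section \<open>The Hankel minors generate the curve ideal\<close>

text \<open>
  This is the classical fact that the 2-minors of all Hankel matrices with the same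
  entries, and with at least two rows and two columns, generate the same ideal. Here
  the row indices run from \<open>0\<close> to \<open>\<rho>\<close> and the column indices from \<open>l\<close> to \<open>l + \<mu>\<close>. If \<open>A\<close>
  and \<open>B\<close> are close to each other, then the wanted binomial is itself a minor of two
  neighbouring rows or of two neighbouring columns. If they are far apart, both of its
  terms are congruent to \<open>y\<^sub>A\<^sub>+\<^sub>\<rho> y\<^sub>B\<^sub>+\<^sub>1\<^sub>-\<^sub>\<rho>\<close>.
\<close>

lemma hankel_minors_imp_adjacent:
  fixes J :: "(nat, 'k::field) mpoly set"
  assumes J: "ideal J (polynomial_ring V)"
    and hankel: "\<And>u v p q. u \<le> \<rho> \<Longrightarrow> v \<le> \<rho> \<Longrightarrow> l \<le> p \<Longrightarrow> p \<le> l + \<mu> \<Longrightarrow> l \<le> q \<Longrightarrow> q \<le> l + \<mu> \<Longrightarrow>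
      pvar (p + u) * pvar (q + v) - pvar (p + v) * pvar (q + u) \<in> J"
    and pos: "\<rho> \<ge> 1" "\<mu> \<ge> 1"
    and AB: "l \<le> A" "A \<le> B" "B < l + \<mu> + \<rho>"
  shows "pvar A * pvar (Suc B) - pvar (Suc A) * pvar B \<in> J"
proof -
  consider (rows) "B - (l + \<mu>) \<le> A - l" | (columns) "B - (l + \<rho>) \<le> A - l"
    | (far) "A - l < B - (l + \<mu>)" "A - l < B - (l + \<rho>)"
    by linarith
  then show ?thesis
  proof cases
    case rows
    let ?u = "B - (l + \<mu>)"
    have "pvar (A - ?u + ?u) * pvar (B - ?u + Suc ?u)
        - pvar (A - ?u + Suc ?u) * pvar (B - ?u + ?u) \<in> J"
      using rows AB pos by (intro hankel) linarith+
    moreover have "A - ?u + ?u = A" "B - ?u + Suc ?u = Suc B" "A - ?u + Suc ?u = Suc A"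
      "B - ?u + ?u = B"
      using rows AB by linarith+
    ultimately show ?thesis by simp
  next
    case columns
    let ?p = "l + (B - (l + \<rho>))"
    have "pvar (?p + (A - ?p)) * pvar (Suc ?p + (B - ?p))
        - pvar (?p + (B - ?p)) * pvar (Suc ?p + (A - ?p)) \<in> J"
      using columns AB pos by (intro hankel) linarith+
    moreover have "?p + (A - ?p) = A" "Suc ?p + (B - ?p) = Suc B" "?p + (B - ?p) = B"
      "Suc ?p + (A - ?p) = Suc A"
      using columns AB by linarith+
    ultimately show ?thesis by (simp add: mult.commute)
  next
    case far
    let ?q = "Suc B - \<rho>"
    have m: "pvar (A + 0) * pvar (?q + \<rho>) - pvar (A + \<rho>) * pvar (?q + 0) \<in> J"
      "pvar (Suc A + 0) * pvar (?q + (\<rho> - 1)) - pvar (Suc A + (\<rho> - 1)) * pvar (?q + 0) \<in> J"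
      using far AB pos by (intro hankel; linarith)+
    have "?q + \<rho> = Suc B" "?q + (\<rho> - 1) = B" "Suc A + (\<rho> - 1) = A + \<rho>"
      using far AB pos by linarith+
    then have "pvar A * pvar (Suc B) - pvar (A + \<rho>) * pvar ?q
        - (pvar (Suc A) * pvar B - pvar (A + \<rho>) * pvar ?q) \<in> J"
      using polynomial_ideal_closed(3)[OF J m] by (simp only: add_0_right)
    then show ?thesis by simp
  qed
qed

lemma I_tilde_eq_curve_ideal:
  assumes n: "n \<ge> 2" and r: "\<And>i. i \<in> {1..n} \<Longrightarrow> r i \<ge> 2" and t: "t \<in> {1..n}"
  shows "I_tilde n r t = (curve_ideal n (sum r {1..n}) :: (nat, 'k::field) mpoly set)"
proof -
  let ?h = "sum r {1..n}"
  have r1: "r i \<ge> 1" if "i \<in> {1..n}" for i using r[OF that] by simp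
  let ?G = "{f n i a b |i a b. a \<in> index_set n r \<and> b \<in> index_set n r \<and> i \<in> {1..t}}
    :: (nat, 'k) mpoly set"
  have "Idl\<^bsub>polynomial_ring {n..?h}\<^esub> ?G = curve_ideal n ?h"
  proof (rule genideal_eqI)
    show "ideal (curve_ideal n ?h :: (nat, 'k) mpoly set) (polynomial_ring {n..?h})"
      using curve_ideal_prime by (rule primeideal.axioms(1))
    show "?G \<subseteq> curve_ideal n ?h"
      using t by (fastforce intro: f_in_curve_ideal)
    fix J :: "(nat, 'k) mpoly set"
    assume J: "ideal J (polynomial_ring {n..?h})" and G: "?G \<subseteq> J"
    have hankel: "pvar (p + u) * pvar (q + v) - pvar (p + v) * pvar (q + u) \<in> J"
      if bounds: "u < r t" "v < r t" "n \<le> p" "p + r t \<le> Suc ?h" "n \<le> q" "q + r t \<le> Suc ?h" for u v p q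
    proof -
      obtain a b where "a \<in> index_set n r" "b \<in> index_set n r"
        and e: "(f n t a b :: (nat, 'k) mpoly)
          = pvar (p + u) * pvar (q + v) - pvar (p + v) * pvar (q + u)"
        by (rule hankel_minor_is_generator[of n r t u v p q, OF r1 t bounds])
      then have "(f n t a b :: (nat, 'k) mpoly) \<in> ?G"
        using t by fastforce
      then show ?thesis using G e by auto
    qed
    \<comment> \<open>This gives the Hankel matrix at least two columns.\<close>
    have "sum (\<lambda>_. 2) ({1..n} - {t}) \<le> sum r ({1..n} - {t})"
      using r by (intro sum_mono) auto
    then have h: "2 * (n - 1) + r t \<le> ?h"
      using sum.remove[of "{1..n}" t r] t by simp
    show "curve_ideal n ?h \<subseteq> J"
    proof (rule curve_ideal_least[OF J])
      fix A B
      assume AB: "n \<le> A" "A \<le> B" "B < ?h"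
      show "pvar A * pvar (Suc B) - pvar (Suc A) * pvar B \<in> J"
      proof (rule hankel_minors_imp_adjacent[OF J, where \<rho> = "r t - 1" and l = n
            and \<mu> = "?h - n - (r t - 1)"])
        fix u v p q
        assume "u \<le> r t - 1" "v \<le> r t - 1" "n \<le> p" "p \<le> n + (?h - n - (r t - 1))"
          "n \<le> q" "q \<le> n + (?h - n - (r t - 1))"
        then show "pvar (p + u) * pvar (q + v) - pvar (p + v) * pvar (q + u) \<in> J"
          using h n r[OF t] by (intro hankel) linarith+
      qed (use h n r[OF t] AB in linarith)+
    qed
  qed
  then show ?thesis
    by (simp only: I_tilde_def R_eq_polynomial_ring[OF r1])
qed

lemma monomial_ideal_eq_line_ideal:
  assumes r: "\<And>i. i \<in> {1..n} \<Longrightarrow> r i \<ge> 1"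
  shows "monomial_ideal n r = (line_ideal n (sum r {1..n}) :: (nat, 'k::field) mpoly set)"
proof -
  let ?h = "sum r {1..n}"
  let ?G = "{xvar n a |a. a \<in> index_set n r \<and> a \<noteq> (\<lambda>i \<in> {1..n}. 1) \<and> a \<noteq> (\<lambda>i \<in> {1..n}. r i)}
    :: (nat, 'k) mpoly set"
  have "Idl\<^bsub>polynomial_ring {n..?h}\<^esub> ?G = line_ideal n ?h"
  proof (rule genideal_eqI)
    show "ideal (line_ideal n ?h :: (nat, 'k) mpoly set) (polynomial_ring {n..?h})"
      using line_ideal_prime by (rule primeideal.axioms(1))
    have "(xvar n a :: (nat, 'k) mpoly) \<in> line_ideal n ?h"
      if a: "a \<in> index_set n r" "a \<noteq> (\<lambda>i\<in>{1..n}. 1)" "a \<noteq> (\<lambda>i\<in>{1..n}. r i)" for a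
      using eq_ones_if_sum_minimal[OF a(1)] eq_r_if_sum_maximal[OF a(1)] sum_in_range[OF a(1)] a(2,3)
      unfolding xvar_eq_pvar by (subst single_in_line_ideal_iff) auto
    then show "?G \<subseteq> line_ideal n ?h" by blast
    fix J :: "(nat, 'k) mpoly set"
    assume J: "ideal J (polynomial_ring {n..?h})" and G: "?G \<subseteq> J"
    show "line_ideal n ?h \<subseteq> J"
    proof (rule line_ideal_least[OF J])
      fix s assume s: "n < s" "s < ?h"
      obtain a where a: "a \<in> index_set n r" "sum a {1..n} = s"
        using exists_index_with_sum[of n r s, OF r] s by auto
      have "sum (\<lambda>i\<in>{1..n}. 1) {1..n} = n" "sum (\<lambda>i\<in>{1..n}. r i) {1..n} = ?h"
        by simp_all
      then have "a \<noteq> (\<lambda>i\<in>{1..n}. 1)" "a \<noteq> (\<lambda>i\<in>{1..n}. r i)"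
        using a(2) s by auto
      then have "(xvar n a :: (nat, 'k) mpoly) \<in> ?G"
        using a(1) by blast
      then show "pvar s \<in> J"
        using G a(2) by (auto simp: xvar_eq_pvar)
    qed
  qed
  then show ?thesis
    by (simp only: monomial_ideal_def R_eq_polynomial_ring[OF r])
qed

section \<open>The two minimal primes\<close>

lemma minimal_primes_eqI:
  assumes "primeideal P A" "primeideal P' A" "J \<subseteq> P" "J \<subseteq> P'" "\<not> P \<subseteq> P'" "\<not> P' \<subseteq> P"
    and "\<And>Q. primeideal Q A \<Longrightarrow> J \<subseteq> Q \<Longrightarrow> P \<subseteq> Q \<or> P' \<subseteq> Q"
  shows "minimal_primes A J = {P, P'}"
proof (rule Set.set_eqI)
  fix Q
  show "Q \<in> minimal_primes A J \<longleftrightarrow> Q \<in> {P, P'}"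
  proof
    assume "Q \<in> minimal_primes A J"
    then have "primeideal Q A" "J \<subseteq> Q"
      and min: "\<And>Q'. primeideal Q' A \<Longrightarrow> J \<subseteq> Q' \<Longrightarrow> Q' \<subseteq> Q \<Longrightarrow> Q' = Q"
      by (simp_all add: minimal_primes_def)
    from assms(7)[OF this(1,2)] show "Q \<in> {P, P'}"
      using min[OF assms(1,3)] min[OF assms(2,4)] by auto
  next
    assume "Q \<in> {P, P'}"
    moreover have "Q' = P" if "primeideal Q' A" "J \<subseteq> Q'" "Q' \<subseteq> P" for Q'
      using assms(7)[OF that(1,2)] that(3) assms(6) by blast
    moreover have "Q' = P'" if "primeideal Q' A" "J \<subseteq> Q'" "Q' \<subseteq> P'" for Q'
      using assms(7)[OF that(1,2)] that(3) assms(5) by blast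
    ultimately show "Q \<in> minimal_primes A J"
      using assms(1-4) by (auto simp: minimal_primes_def)
  qed
qed

theorem theorem5p3:
  fixes n t :: nat and r :: "nat \<Rightarrow> nat"
  assumes "n \<ge> 3"
    and "\<And>i. i \<in> {1..n} \<Longrightarrow> r i \<ge> 2"
    and "t \<in> {1..n}"
  shows "minimal_primes (R n r :: (nat, 'k::field) mpoly ring) (I_ideal n r t)
           = {I_tilde n r t, monomial_ideal n r}
         \<and> (I_tilde n r t :: (nat, 'k) mpoly set) \<noteq> monomial_ideal n r"
proof -
  let ?h = "sum r {1..n}"
  let ?A = "polynomial_ring {n..?h} :: (nat, 'k) mpoly ring"
  let ?C = "curve_ideal n ?h :: (nat, 'k) mpoly set"
  let ?L = "line_ideal n ?h :: (nat, 'k) mpoly set"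
  let ?G = "{f n i a b |i a b. a \<in> index_set n r \<and> b \<in> index_set n r \<and> d n a b = 2 \<and> i \<in> {1..t}}
    :: (nat, 'k) mpoly set"
  have n2: "n \<ge> 2" and r1: "\<And>i. i \<in> {1..n} \<Longrightarrow> r i \<ge> 1"
    using assms(1,2) by fastforce+
  have "sum (\<lambda>_. 2) {1..n} \<le> ?h"
    by (intro sum_mono assms)
  then have h: "n + 3 \<le> ?h" using assms(1) by simp
  have R: "R n r = ?A" by (rule R_eq_polynomial_ring[OF r1])
  have C: "ideal ?C ?A" and L: "ideal ?L ?A"
    using curve_ideal_prime line_ideal_prime by (blast intro: primeideal.axioms(1))+
  have GC: "?G \<subseteq> ?C"
    using assms(3) by (fastforce intro: f_in_curve_ideal)
  have GL: "?G \<subseteq> ?L"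
    using assms(3) by (fastforce intro: f_in_line_ideal[OF assms(1,2)])
  have G: "?G \<subseteq> carrier ?A"
    using GC polynomial_ideal_closed(6)[OF C] by blast
  have I: "I_ideal n r t = Idl\<^bsub>?A\<^esub> ?G"
    by (simp only: I_ideal_def R)
  have CL: "\<not> ?C \<subseteq> ?L"
  proof
    \<comment> \<open>The quadric \<open>y\<^sub>n y\<^sub>h - y\<^sub>n\<^sub>+\<^sub>1 y\<^sub>h\<^sub>-\<^sub>1\<close> vanishes on the curve, but not on the line.\<close>
    assume "?C \<subseteq> ?L"
    moreover have "pvar n * pvar ?h - pvar (n + 1) * pvar (?h - 1) \<in> ?C"
      using h by (subst quadric_in_curve_ideal_iff) auto
    moreover have "pvar (n + 1) * pvar (?h - 1) \<in> ?L"
      using h unfolding mult_single mult_1_left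
      by (subst single_in_line_ideal_iff) (auto simp: keys_add_nat)
    ultimately have "pvar n * pvar ?h \<in> ?L"
      using polynomial_ideal_closed(2)[OF L] by fastforce
    then have "Poly_Mapping.single (Poly_Mapping.single n 1 + Poly_Mapping.single ?h 1) 1 \<in> ?L"
      by (simp add: mult_single)
    then show False
      using h by (subst (asm) single_in_line_ideal_iff) (auto simp: keys_add_nat)
  qed
  have "minimal_primes ?A (I_ideal n r t) = {?C, ?L}"
  proof (rule minimal_primes_eqI)
    show "I_ideal n r t \<subseteq> ?C" "I_ideal n r t \<subseteq> ?L"
      unfolding I by (rule genideal_polynomial_ring(3)[OF G]; fact)+
    show "\<not> ?C \<subseteq> ?L" by (rule CL)
    show "\<not> ?L \<subseteq> ?C"
    proof
      assume "?L \<subseteq> ?C"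
      moreover have "pvar (n + 1) \<in> ?L"
        using h by (subst single_in_line_ideal_iff) auto
      ultimately show False
        by (auto simp: curve_ideal_def lin_ext_single monomial_map_def monom_eq_0_iff)
    qed
    fix Q assume Q: "primeideal Q ?A" and IQ: "I_ideal n r t \<subseteq> Q"
    have "pvar c * pvar (c + 2) - pvar (c + 1) * pvar (c + 1) \<in> Q"
      if c: "n \<le> c" "c + 2 \<le> ?h" for c
    proof -
      obtain a b where "a \<in> index_set n r" "b \<in> index_set n r" "d n a b = 2"
        and e: "(f n t a b :: (nat, 'k) mpoly) = pvar c * pvar (c + 2) - pvar (c + 1) * pvar (c + 1)"
        by (rule consecutive_minor_is_generator[of n r t c, OF n2 assms(2,3) c])
      then have "(f n t a b :: (nat, 'k) mpoly) \<in> ?G"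
        using assms(3) by fastforce
      then show ?thesis
        using IQ genideal_polynomial_ring(2)[OF G] unfolding I e by blast
    qed
    then show "?C \<subseteq> Q \<or> ?L \<subseteq> Q"
      by (rule prime_over_consecutive_minors[OF Q])
  qed (rule curve_ideal_prime line_ideal_prime)+
  moreover have "?C \<noteq> ?L"
    using CL by blast
  ultimately show ?thesis
    by (simp only: R I_tilde_eq_curve_ideal[OF n2 assms(2,3)] monomial_ideal_eq_line_ideal[OF r1]) simp
qed

end
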